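(* Let $A\in\mathbb{R}^{n\times n}$, $B\in\mathbb{R}^{n\times m}$, $C\in\mathbb{R}^{m\times n}$, $D\in\mathbb{R}^{m\times m}$, $F\in\mathbb{R}^{r\times n}$, $G\in\mathbb{R}^{r\times m}$, and consider the implicit Lur'e system $$x(t+1)=Ax(t)+Bu(t),\qquad 0\in Cx(t)+Du(t)+\Psi_t(Fx(t)+Gu(t)),$$ with set-valued mappings $\Psi_t:\mathbb{R}^r\to\mathcal{P}(\mathbb{R}^m)$, $t\in\mathbb{N}$. Suppose $\Psi_t(z)=\alpha\Psi_t^{\mathrm{base}}(z)$ with $\alpha>0$, and let $\Psi_t^{\mathrm{base}}:\mathbb{R}^r\to\mathcal{P}(\mathbb{R}^m)$ admit the incremental multiplier matrices (IMMs) $\begin{bmatrix}M_{11}^i&M_{12}^i\\ (M_{12}^i)^\top&M_{22}^i\end{bmatrix}$, $i=1,\dots,p$, for each $t\in\mathbb{N}$, where $M_{11}^i\in\mathbb{R}^{r\times r}$, $M_{12}^i\in\mathbb{R}^{r\times m}$, $M_{22}^i\in\mathbb{R}^{m\times m}$. Then $\Psi_t$ admits the IMMs $$\begin{bmatrix}M_{11}^i&\frac1\alpha M_{12}^i\\ \frac1\alpha(M_{12}^i)^\top&\frac1{\alpha^2}M_{22}^i\end{bmatrix},\quad i=1,\dots,p.$$ Furthermore, suppose that $D$ is invertible, $A-BD^{-1}C$ is Schur, and there exist nonnegative scalars $\bar\lambda_1,\dots,\bar\lambda_p$ such that $\bar M_{22}:=\sum_{i=1}^p\bar\lambda_iM_{22}^i\prec0$.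 Then, for any $\eta\in(\rho(A-BD^{-1}C),1)$, there exist a positive definite matrix $P\in\mathbb{R}^{n\times n}$, nonnegative scalars $\lambda_1,\dots,\lambda_p$, and a positive scalar $\alpha$ satisfying $$\begin{bmatrix}A^\top PA-\eta^2P&A^\top PB\\ B^\top PA&B^\top PB\end{bmatrix}+\mathtt{sol}\Big(\sum_{i=1}^p\lambda_i\begin{bmatrix}M_{11}^i&\frac1\alpha M_{12}^i\\ \frac1\alpha(M_{12}^i)^\top&\frac1{\alpha^2}M_{22}^i\end{bmatrix}\Big)\prec0,$$ where $\mathtt{sol}(M):=\begin{bmatrix}F&G\\ -C&-D\end{bmatrix}^\top M\begin{bmatrix}F&G\\ -C&-D\end{bmatrix}$.
   Context: $\mathcal{P}(S)$ is the power set of $S$; $\alpha S=\{\alpha s: s\in S\}$. A set-valued mapping $\Psi:\mathbb{R}^{a}\to\mathcal{P}(\mathbb{R}^{b})$ admits the symmetric matrix $M\in\mathbb{R}^{(a+b)\times(a+b)}$ as an incremental multiplier matrix (IMM) if, for all $z^{(1)},z^{(2)}\in\mathbb{R}^a$ and all $g^{(1)}\in\Psi(z^{(1)})$, $g^{(2)}\in\Psi(z^{(2)})$, $$\begin{bmatrix}z^{(1)}-z^{(2)}\\ g^{(1)}-g^{(2)}\end{bmatrix}^\top M\begin{bmatrix}z^{(1)}-z^{(2)}\\ g^{(1)}-g^{(2)}\end{bmatrix}\ge0.$$ $\rho(\cdot)$ is the spectral radius; a matrix is Schur if its spectral radius is less than 1. Positive/negative definite matrices are symmetric. *)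

theory Defs
  imports "HOL-Analysis.Analysis"
begin

definition join_vec :: "real ^ 'a::finite \<Rightarrow> real ^ 'b::finite \<Rightarrow> real ^ ('a + 'b)" where
  "join_vec z g = (\<chi> i. case i of Inl a \<Rightarrow> z $ a | Inr b \<Rightarrow> g $ b)"

definition block_mat ::
  "real ^ 'c::finite ^ 'a::finite \<Rightarrow> real ^ 'd::finite ^ 'a \<Rightarrow>
   real ^ 'c ^ 'b::finite \<Rightarrow> real ^ 'd ^ 'b \<Rightarrow> real ^ ('c + 'd) ^ ('a + 'b)" where
  "block_mat M11 M12 M21 M22 =
    (\<chi> i. case i of Inl a \<Rightarrow> join_vec (M11 $ a) (M12 $ a)
                 | Inr b \<Rightarrow> join_vec (M21 $ b) (M22 $ b))"

definition pos_def :: "real ^ 'n ^ 'n \<Rightarrow> bool" where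
  "pos_def M \<longleftrightarrow> transpose M = M \<and> (\<forall>x. x \<noteq> 0 \<longrightarrow> x \<bullet> (M *v x) > 0)"

definition neg_def :: "real ^ 'n ^ 'n \<Rightarrow> bool" where
  "neg_def M \<longleftrightarrow> transpose M = M \<and> (\<forall>x. x \<noteq> 0 \<longrightarrow> x \<bullet> (M *v x) < 0)"

(* The complex spectrum of a real matrix. It is finite, and nonempty because index types are
   nonempty, so the maximum in spectral_radius is meaningful. *)
definition eigenvalues :: "real ^ 'n ^ 'n \<Rightarrow> complex set" where
  "eigenvalues A =
    {k. \<exists>v::complex ^ 'n. v \<noteq> 0 \<and> map_matrix complex_of_real A *v v = k *s v}"

definition spectral_radius :: "real ^ 'n ^ 'n \<Rightarrow> real" where
  "spectral_radius A = Max (cmod ` eigenvalues A)"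

definition schur :: "real ^ 'n ^ 'n \<Rightarrow> bool" where
  "schur A \<longleftrightarrow> spectral_radius A < 1"

definition admits_IMM ::
  "(real ^ 'a::finite \<Rightarrow> (real ^ 'b::finite) set) \<Rightarrow> real ^ ('a + 'b) ^ ('a + 'b) \<Rightarrow> bool" where
  "admits_IMM \<Psi> M \<longleftrightarrow> transpose M = M \<and>
    (\<forall>z1 z2. \<forall>g1 \<in> \<Psi> z1. \<forall>g2 \<in> \<Psi> z2.
      join_vec (z1 - z2) (g1 - g2) \<bullet> (M *v join_vec (z1 - z2) (g1 - g2)) \<ge> 0)"

definition scaled_multiplier ::
  "real \<Rightarrow> real ^ 'r::finite ^ 'r \<Rightarrow> real ^ 'm::finite ^ 'r \<Rightarrow> real ^ 'm ^ 'm \<Rightarrow>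
   real ^ ('r + 'm) ^ ('r + 'm)" where
  "scaled_multiplier \<alpha> M11 M12 M22 =
    block_mat M11 ((1 / \<alpha>) *\<^sub>R M12) ((1 / \<alpha>) *\<^sub>R transpose M12) ((1 / \<alpha>\<^sup>2) *\<^sub>R M22)"

definition sol ::
  "real ^ 'n::finite ^ 'r::finite \<Rightarrow> real ^ 'm::finite ^ 'r \<Rightarrow> real ^ 'n ^ 'm \<Rightarrow> real ^ 'm ^ 'm \<Rightarrow>
   real ^ ('r + 'm) ^ ('r + 'm) \<Rightarrow> real ^ ('n + 'm) ^ ('n + 'm)" where
  "sol F G C D M = transpose (block_mat F G (- C) (- D)) ** M ** block_mat F G (- C) (- D)"

end

theory Submission
  imports Defs "HOL-Computational_Algebra.Fundamental_Theorem_Algebra"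
begin

text \<open>
  Scaling. If \<open>g = \<alpha> h\<close>, then the form of the scaled multiplier at \<open>(z, g)\<close> equals the form of the original
  one at \<open>(z, h)\<close> (\<open>scaled_multiplier_form\<close>). Hence multipliers of the base mapping turn into
  multipliers of the scaled mapping (\<open>admits_IMM_scaled\<close>).

  The matrix inequality. Write \<open>S = A - B D\<^sup>-\<^sup>1 C\<close>. Since \<open>D\<close> is invertible, the input can be eliminated
  in favour of \<open>h = -(C x + D u) / \<alpha>\<close>, and then \<open>A x + B u = S x - \<alpha> B D\<^sup>-\<^sup>1 h\<close>. With the weights \<open>\<lambda>\<close> fixed
  to those that make the combined block \<open>M22\<close> negative definite and \<open>P = k P\<^sub>0\<close>, the quadratic form of the
  inequality becomes
  \<open>k (|S x - \<alpha> B D\<^sup>-\<^sup>1 h|\<^sup>2 - \<eta>\<^sup>2 |x|\<^sup>2) + [z; h]\<^sup>T M [z; h]\<close>, where the norm is that of \<open>P\<^sub>0\<close>, \<open>M\<close> is the combined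
  multiplier and \<open>z = F x + G u\<close> is affine in \<open>\<alpha>\<close>. For \<open>\<alpha> = 0\<close> the bracket does not involve \<open>h\<close>; it is negative for \<open>x \<noteq> 0\<close> if \<open>P\<^sub>0\<close>
  solves the Stein inequality \<open>S\<^sup>T P\<^sub>0 S \<prec> \<eta>\<^sup>2 P\<^sub>0\<close>. On the subspace \<open>x = 0\<close>, where the bracket vanishes,
  the remaining term is \<open>h\<^sup>T M22 h < 0\<close>. By Finsler's argument a large \<open>k\<close> makes the whole form
  negative on the unit sphere at \<open>\<alpha> = 0\<close>, and by compactness it stays negative for small
  \<open>\<alpha> > 0\<close> (\<open>finsler_perturbed\<close>, \<open>exists_scaled_lmi_solution\<close>).

  The Stein inequality (\<open>stein_solution\<close>) is solved by a finite sum of Gram matrices of powers of \<open>S\<close>, once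
  some power satisfies \<open>|S\<^sup>N x| < \<eta>\<^sup>N |x|\<close> for \<open>x \<noteq> 0\<close>. This follows from the growth bound
  \<open>|S\<^sup>k x| \<le> K r\<^sup>k |x|\<close> for every \<open>r\<close> above the spectral radius (\<open>orbit_growth\<close>), which is proved
  by splitting an annihilating polynomial over the complex numbers into linear factors.
\<close>

section \<open>Polynomials of a complex matrix\<close>

text \<open>
  The complexification of a real matrix is only a special case here: the arguments below apply
  polynomials with complex roots, so they are stated for all complex matrices.
\<close>

definition eigenvalues_complex :: "complex ^ 'n ^ 'n \<Rightarrow> complex set" where
  "eigenvalues_complex M = {k. \<exists>v. v \<noteq> 0 \<and> M *v v = k *s v}"

definition poly_apply :: "complex ^ 'n ^ 'n \<Rightarrow> complex poly \<Rightarrow> complex ^ 'n \<Rightarrow> complex ^ 'n" where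
  "poly_apply M p v = (\<Sum>i\<le>degree p. coeff p i *s ((*v) M ^^ i) v)"

lemma funpow_mult_diff:
  fixes M :: "complex ^ 'n ^ 'n"
  shows "((*v) M ^^ i) (x - y) = ((*v) M ^^ i) x - ((*v) M ^^ i) y"
  by (induction i) (simp_all add: matrix_vector_mult_diff_distrib)

lemma funpow_mult_scale:
  fixes M :: "complex ^ 'n ^ 'n"
  shows "((*v) M ^^ i) (a *s x) = a *s ((*v) M ^^ i) x"
  by (induction i) (simp_all add: vector_scalar_commute)

text \<open>
  A summation range independent of the degree lets polynomials of different degrees be combined
  termwise.
\<close>

lemma poly_apply_bound:
  fixes M :: "complex ^ 'n ^ 'n"
  assumes "degree p \<le> N"
  shows "poly_apply M p v = (\<Sum>i\<le>N. coeff p i *s ((*v) M ^^ i) v)"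
  unfolding poly_apply_def using assms
  by (intro sum.mono_neutral_left) (auto simp: coeff_eq_0)

lemma poly_apply_linear_factor:
  fixes M :: "complex ^ 'n ^ 'n"
  shows "poly_apply M ([:-a, 1:] * q) v = poly_apply M q (M *v v - a *s v)"
proof -
  define N where "N = degree q"
  have coeff_mult_factor: "coeff ([:-a, 1:] * q) i = coeff (pCons 0 q) i - a * coeff q i" for i
    by simp
  have "degree ([:-a, 1:] * q) \<le> Suc N"
    using degree_mult_le[of "[:-a, 1:]" q] by (simp add: N_def)
  then have "poly_apply M ([:-a, 1:] * q) v
      = (\<Sum>i\<le>Suc N. coeff ([:-a, 1:] * q) i *s ((*v) M ^^ i) v)"
    by (rule poly_apply_bound)
  also have "\<dots> = (\<Sum>i\<le>Suc N. coeff (pCons 0 q) i *s ((*v) M ^^ i) v)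
      - (\<Sum>i\<le>Suc N. (a * coeff q i) *s ((*v) M ^^ i) v)"
    by (simp only: coeff_mult_factor vec.scale_left_diff_distrib sum_subtractf)
  also have "(\<Sum>i\<le>Suc N. coeff (pCons 0 q) i *s ((*v) M ^^ i) v)
      = (\<Sum>i\<le>N. coeff q i *s ((*v) M ^^ i) (M *v v))"
    by (subst sum.atMost_Suc_shift) (simp add: funpow_swap1)
  also have "(\<Sum>i\<le>Suc N. (a * coeff q i) *s ((*v) M ^^ i) v)
      = (\<Sum>i\<le>N. coeff q i *s ((*v) M ^^ i) (a *s v))"
    by (simp add: N_def coeff_eq_0 funpow_mult_scale mult.commute vector_smult_assoc)
  finally show ?thesis
    by (simp add: poly_apply_def N_def funpow_mult_diff sum_subtractf vec.scale_right_diff_distrib)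
qed

lemma poly_apply_eigenvector:
  fixes M :: "complex ^ 'n ^ 'n"
  assumes "M *v v = k *s v"
  shows "poly_apply M p v = poly p k *s v"
proof -
  have "((*v) M ^^ i) v = k ^ i *s v" for i
    by (induction i) (simp_all add: assms vector_scalar_commute vector_smult_assoc mult.commute)
  then show ?thesis
    by (simp add: poly_apply_def poly_altdef vec.scale_sum_left vector_smult_assoc)
qed

text \<open>
  Repeated terms need separate treatment because linear dependence is a property of the set of values:
  if two terms agree, their difference is the relation.
\<close>

lemma linear_relation_of_sequence:
  fixes f :: "nat \<Rightarrow> 'a::euclidean_space"
  obtains c :: "nat \<Rightarrow> real" and m :: nat
  where "m \<le> DIM('a)" "c m \<noteq> 0" "(\<Sum>i\<le>DIM('a). c i *\<^sub>R f i) = 0"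
proof (cases "inj_on f {..DIM('a)}")
  case True
  have "dependent (f ` {..DIM('a)})"
    by (intro dependent_biggerset) (simp add: card_image True)
  then obtain u where u: "\<exists>v\<in>f ` {..DIM('a)}. u v \<noteq> 0" "(\<Sum>v\<in>f ` {..DIM('a)}. u v *\<^sub>R v) = 0"
    by (auto simp: dependent_finite)
  then obtain m where "m \<le> DIM('a)" "u (f m) \<noteq> 0" by auto
  then show thesis
    using that[of m "\<lambda>i. u (f i)"] u(2) by (simp add: sum.reindex[OF True])
next
  case False
  then obtain i j where ij: "i \<le> DIM('a)" "j \<le> DIM('a)" "i \<noteq> j" "f i = f j"
    by (auto simp: inj_on_def)
  define c :: "nat \<Rightarrow> real" where "c = (\<lambda>k. (if k = i then 1 else 0) - (if k = j then 1 else 0))"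
  have "(\<Sum>k\<le>DIM('a). c k *\<^sub>R f k)
      = (\<Sum>k\<le>DIM('a). if k = i then f k else 0) - (\<Sum>k\<le>DIM('a). if k = j then f k else 0)"
    by (subst sum_subtractf[symmetric], rule sum.cong) (auto simp: c_def)
  also have "\<dots> = 0" using ij by simp
  finally show thesis using that[of i c] ij by (simp add: c_def)
qed

lemma sum_matrix_vector_mult: "(\<Sum>i\<in>I. f i) *v x = (\<Sum>i\<in>I. f i *v (x :: 'a :: ring_1 ^ 'n))"
  by (induction I rule: infinite_finite_induct) (simp_all add: matrix_vector_mult_add_rdistrib)

text \<open>
  The matrices form a finite-dimensional real space, so the powers of \<open>M\<close> satisfy a linear relation.
\<close>

lemma annihilating_polynomial:
  fixes M :: "complex ^ 'n ^ 'n"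
  obtains p where "p \<noteq> 0" "\<And>v. poly_apply M p v = 0"
proof -
  define N where "N = DIM(complex ^ 'n ^ 'n)"
  define Q where "Q i = ((**) M ^^ i) (mat 1)" for i
  have Q: "Q i *v v = ((*v) M ^^ i) v" for i v
    unfolding Q_def by (induction i) (simp_all add: matrix_vector_mul_assoc[symmetric])
  obtain c :: "nat \<Rightarrow> real" and m where c: "m \<le> N" "c m \<noteq> 0" "(\<Sum>i\<le>N. c i *\<^sub>R Q i) = 0"
    unfolding N_def using linear_relation_of_sequence[of Q] by blast
  define p where "p = (\<Sum>i\<le>N. monom (complex_of_real (c i)) i)"
  have co: "coeff p i = (if i \<le> N then of_real (c i) else 0)" for i
    by (simp add: p_def coeff_sum if_distrib cong: if_cong)
  have "degree p \<le> N" by (rule degree_le) (simp add: co)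
  have "poly_apply M p v = 0" for v
  proof -
    have "poly_apply M p v = (\<Sum>i\<le>N. (of_real (c i) :: complex) *s (Q i *v v))"
      by (subst poly_apply_bound[OF \<open>degree p \<le> N\<close>]) (simp add: co Q)
    also have "\<dots> = (\<Sum>i\<le>N. (c i *\<^sub>R Q i) *v v)"
      by (simp add: vec_eq_iff matrix_vector_mult_def sum_distrib_left mult.assoc
          scaleR_conv_of_real[where 'a = complex])
    also have "\<dots> = (\<Sum>i\<le>N. c i *\<^sub>R Q i) *v v"
      by (simp add: sum_matrix_vector_mult)
    finally show ?thesis by (simp add: c)
  qed
  moreover have "p \<noteq> 0" using co[of m] c by auto
  ultimately show thesis using that by blast
qed

text \<open>
  Every eigenvalue is a root of an annihilating polynomial.
\<close>

lemma finite_eigenvalues_complex: "finite (eigenvalues_complex M)"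
proof -
  obtain p where p: "p \<noteq> 0" "\<And>v. poly_apply M p v = 0" using annihilating_polynomial[of M] by metis
  have "eigenvalues_complex M \<subseteq> {k. poly p k = 0}"
  proof
    fix k assume "k \<in> eigenvalues_complex M"
    then obtain v where v: "v \<noteq> 0" "M *v v = k *s v" by (auto simp: eigenvalues_complex_def)
    then have "poly p k *s v = 0" using p(2) by (simp flip: poly_apply_eigenvector)
    with v(1) show "k \<in> {k. poly p k = 0}" by simp
  qed
  then show ?thesis using poly_roots_finite[OF p(1)] finite_subset by blast
qed

section \<open>Spectrum and growth of orbits\<close>

text \<open>
  This packages the fundamental theorem of algebra for inductions on the degree that peel off
  one linear factor \<open>M - a\<close> at a time.
\<close>

lemma linear_factor_cases:
  fixes p :: "complex poly"
  assumes "p \<noteq> 0"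
  obtains (const) c where "c \<noteq> 0" "p = [:c:]"
    | (factor) a q where "q \<noteq> 0" "p = [:-a, 1:] * q" "degree q < degree p"
proof (cases "degree p = 0")
  case True
  then obtain c where "p = [:c:]" by (rule degree_eq_zeroE)
  with assms const show ?thesis by auto
next
  case False
  then obtain a where "poly p a = 0"
    using fundamental_theorem_of_algebra[of p] by (auto simp: constant_degree)
  then have "[:-a, 1:] dvd p" by (simp only: poly_eq_0_iff_dvd)
  then obtain q where q: "p = [:-a, 1:] * q" by (rule dvdE)
  with assms have "q \<noteq> 0" by (metis mult_zero_right)
  then have "degree q < degree p" unfolding q by (subst degree_mult_eq) simp_all
  then show ?thesis using factor \<open>q \<noteq> 0\<close> q by blast
qed

lemma poly_apply_const: "poly_apply M [:c:] v = c *s v"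
  by (simp add: poly_apply_def)

text \<open>
  Without eigenvalues every factor \<open>M - a\<close> is injective, so the factors of an annihilating
  polynomial could be cancelled one after the other until every vector is zero.
\<close>

lemma eigenvalues_complex_nonempty:
  fixes M :: "complex ^ 'n ^ 'n"
  shows "eigenvalues_complex M \<noteq> {}"
proof
  assume empty: "eigenvalues_complex M = {}"
  have zero: "v = 0" if "p \<noteq> 0" "poly_apply M p v = 0" for p v
    using that
  proof (induction "degree p" arbitrary: p v rule: less_induct)
    case less
    from less.prems(1) show ?case
    proof (cases rule: linear_factor_cases)
      case (const c)
      then show ?thesis using less.prems(2) by (simp add: poly_apply_const)
    next
      case (factor a q)
      have "poly_apply M q (M *v v - a *s v) = 0"
        using factor less.prems(2) by (simp only: poly_apply_linear_factor)
      then have "M *v v - a *s v = 0"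
        using less.hyps[of q] factor by blast
      then show ?thesis using empty by (auto simp: eigenvalues_complex_def)
    qed
  qed
  obtain p where "p \<noteq> 0" "\<And>v. poly_apply M p v = 0" using annihilating_polynomial[of M] by metis
  then have "axis undefined 1 = (0 :: complex ^ 'n)" using zero by blast
  then show False by simp
qed

lemma norm_vector_smult: "norm (c *s v) = cmod c * norm (v :: complex ^ 'n)"
  by (simp add: norm_vec_def norm_mult L2_set_right_distrib)

text \<open>
  This is how one eigenvalue of modulus \<open>s\<close> acts on growth: a forcing term of rate \<open>r\<close> strictly above
  \<open>s\<close> does not change the rate of the solution.
\<close>

lemma orbit_bound_of_linear_recurrence:
  fixes a :: "nat \<Rightarrow> real"
  assumes "0 \<le> s" "s < r" and step: "\<And>k. a (Suc k) \<le> s * a k + C * r ^ k"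
  obtains K where "\<And>k. a k \<le> K * r ^ k"
proof -
  define K where "K = max (a 0) (C / (r - s))"
  have "a k \<le> K * r ^ k" for k
  proof (induction k)
    case 0 show ?case by (simp add: K_def)
  next
    case (Suc k)
    have "C / (r - s) \<le> K" by (simp add: K_def)
    then have C: "C \<le> K * (r - s)" using \<open>s < r\<close> by (simp add: field_simps)
    have "s * a k \<le> s * (K * r ^ k)" using Suc \<open>0 \<le> s\<close> by (rule mult_left_mono)
    moreover have "C * r ^ k \<le> K * (r - s) * r ^ k"
      using C assms(1,2) by (intro mult_right_mono) auto
    ultimately have "a (Suc k) \<le> s * (K * r ^ k) + K * (r - s) * r ^ k"
      using step[of k] by linarith
    then show ?case by (simp add: algebra_simps)
  qed
  then show thesis by (rule that)
qed

text \<open>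
  The proof is by induction on the degree of a polynomial that annihilates \<open>v\<close>. If \<open>M - a\<close> is a factor,
  the orbit of \<open>w = M v - a v\<close> is covered by the induction hypothesis, and \<open>w\<^sub>k = v\<^sub>k\<^sub>+\<^sub>1 - a v\<^sub>k\<close> transfers the
  bound to the orbit of \<open>v\<close>: by the scalar recurrence if \<open>a\<close> is an eigenvalue (so \<open>|a| < r\<close>), and
  by bounded invertibility of \<open>M - a\<close> otherwise. Hence any annihilating
  polynomial will do, including one with roots outside the spectrum.
\<close>

lemma orbit_growth_complex:
  fixes M :: "complex ^ 'n ^ 'n"
  assumes "r > 0" and spec: "\<And>a. a \<in> eigenvalues_complex M \<Longrightarrow> cmod a < r"
  obtains K where "\<And>k. norm (((*v) M ^^ k) v) \<le> K * r ^ k"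
proof -
  have "\<exists>K. \<forall>k. norm (((*v) M ^^ k) v) \<le> K * r ^ k" if "p \<noteq> 0" "poly_apply M p v = 0" for p v
    using that
  proof (induction "degree p" arbitrary: p v rule: less_induct)
    case less
    from less.prems(1) show ?case
    proof (cases rule: linear_factor_cases)
      case (const c)
      with less.prems(2) have "v = 0" by (simp add: poly_apply_const)
      moreover have "((*v) M ^^ k) 0 = 0" for k by (induction k) simp_all
      ultimately show ?thesis by (intro exI[of _ 0]) simp
    next
      case (factor a q)
      define w where "w = M *v v - a *s v"
      have "poly_apply M q w = 0"
        using factor less.prems(2) by (simp only: poly_apply_linear_factor w_def)
      then obtain C where C: "\<And>k. norm (((*v) M ^^ k) w) \<le> C * r ^ k"
        using less.hyps[of q w] factor by blast
      have w: "((*v) M ^^ k) w = M *v (((*v) M ^^ k) v) - a *s ((*v) M ^^ k) v" for k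
        by (simp add: w_def funpow_mult_diff funpow_mult_scale funpow_swap1)
      show ?thesis
      proof (cases "a \<in> eigenvalues_complex M")
        case True
        have "norm (((*v) M ^^ Suc k) v) \<le> cmod a * norm (((*v) M ^^ k) v) + C * r ^ k" for k
        proof -
          have "((*v) M ^^ Suc k) v = a *s ((*v) M ^^ k) v + ((*v) M ^^ k) w" by (simp add: w)
          also have "norm \<dots> \<le> cmod a * norm (((*v) M ^^ k) v) + C * r ^ k"
            using norm_triangle_ineq C[of k] by (smt (verit) norm_vector_smult)
          finally show ?thesis .
        qed
        then show ?thesis
          using orbit_bound_of_linear_recurrence[of "cmod a" r "\<lambda>k. norm (((*v) M ^^ k) v)" C]
            spec[OF True] norm_ge_zero[of a] by metis
      next
        case False
        have lin: "linear (\<lambda>u. M *v u - a *s u)"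
          by (intro linear_compose_sub matrix_vector_mul_linear)
            (simp add: linear_iff vec_eq_iff algebra_simps)
        have "inj (\<lambda>u. M *v u - a *s u)"
          unfolding linear_injective_0[OF lin] using False by (auto simp: eigenvalues_complex_def)
        with lin obtain B where B: "B > 0" "\<And>u. B * norm u \<le> norm (M *v u - a *s u)"
          by (rule linear_inj_bounded_below_pos) blast
        have "norm (((*v) M ^^ k) v) \<le> (C / B) * r ^ k" for k
          using B(2)[of "((*v) M ^^ k) v"] C[of k] \<open>B > 0\<close> by (simp add: w field_simps)
        then show ?thesis by blast
      qed
    qed
  qed
  moreover obtain p where "p \<noteq> 0" "\<And>v. poly_apply M p v = 0" using annihilating_polynomial[of M] by metis
  ultimately show thesis using that by metis
qed

text \<open>
  The maximum that defines the spectral radius is over a finite nonempty set, so it is attained and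
  bounds every eigenvalue.
\<close>

lemma spectral_radius_bounds:
  fixes S :: "real ^ 'n ^ 'n"
  shows "0 \<le> spectral_radius S"
    and "a \<in> eigenvalues S \<Longrightarrow> cmod a \<le> spectral_radius S"
proof -
  have eq: "eigenvalues S = eigenvalues_complex (map_matrix complex_of_real S)"
    by (simp add: eigenvalues_def eigenvalues_complex_def)
  have fin: "finite (eigenvalues S)" and "eigenvalues S \<noteq> {}"
    by (simp_all only: eq finite_eigenvalues_complex eigenvalues_complex_nonempty not_False_eq_True)
  show le: "cmod a \<le> spectral_radius S" if "a \<in> eigenvalues S" for a
    unfolding spectral_radius_def using fin that by (intro Max_ge) auto
  from \<open>eigenvalues S \<noteq> {}\<close> obtain b where "b \<in> eigenvalues S" by blast
  then show "0 \<le> spectral_radius S" using le[of b] norm_ge_zero[of b] by linarith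
qed

text \<open>
  The complex bound has a constant that depends on the starting vector; expanding in
  the standard basis makes it uniform in \<open>x\<close>.
\<close>

lemma orbit_growth:
  fixes S :: "real ^ 'n ^ 'n"
  assumes "spectral_radius S < r"
  obtains K where "\<And>k x. norm (((*v) S ^^ k) x) \<le> K * r ^ k * norm x"
proof -
  define M where "M = map_matrix complex_of_real S"
  define emb :: "real ^ 'n \<Rightarrow> complex ^ 'n" where "emb = (\<lambda>x. \<chi> i. complex_of_real (x $ i))"
  have r: "r > 0" using assms spectral_radius_bounds(1)[of S] by linarith
  have norm_emb: "norm (emb x) = norm x" for x
    by (simp add: emb_def norm_vec_def)
  have emb: "((*v) M ^^ k) (emb x) = emb (((*v) S ^^ k) x)" for k x
    by (induction k) (simp_all add: emb_def M_def matrix_vector_mult_def vec_eq_iff)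
  have "\<exists>K. \<forall>k. norm (((*v) S ^^ k) b) \<le> K * r ^ k" for b
  proof -
    have "cmod a < r" if "a \<in> eigenvalues_complex M" for a
      using spectral_radius_bounds(2)[of a S] that assms
      by (simp add: M_def eigenvalues_def eigenvalues_complex_def)
    then obtain K where "\<And>k. norm (((*v) M ^^ k) (emb b)) \<le> K * r ^ k"
      using orbit_growth_complex[OF r, of M "emb b"] by blast
    then show ?thesis by (auto simp: emb norm_emb)
  qed
  then obtain K where K: "\<And>b k. norm (((*v) S ^^ k) b) \<le> K b * r ^ k" by metis
  have lin: "linear ((*v) S ^^ k)" for k
    by (induction k) (simp_all add: linear_iff matrix_vector_right_distrib matrix_vector_mult_scaleR)
  have "norm (((*v) S ^^ k) x) \<le> (\<Sum>b\<in>Basis. K b) * r ^ k * norm x" for k x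
  proof -
    have "((*v) S ^^ k) x = ((*v) S ^^ k) (\<Sum>b\<in>Basis. (x \<bullet> b) *\<^sub>R b)"
      by (simp add: euclidean_representation)
    also have "\<dots> = (\<Sum>b\<in>Basis. (x \<bullet> b) *\<^sub>R ((*v) S ^^ k) b)"
      by (simp add: linear_sum[OF lin] linear_scale[OF lin])
    also have "norm \<dots> \<le> (\<Sum>b\<in>Basis. norm x * (K b * r ^ k))"
      by (rule sum_norm_le) (simp add: mult_mono Basis_le_norm K)
    also have "\<dots> = (\<Sum>b\<in>Basis. K b) * r ^ k * norm x"
      by (simp add: sum_distrib_left[symmetric] sum_distrib_right[symmetric] mult_ac)
    finally show ?thesis .
  qed
  then show thesis by (rule that)
qed

lemma power_contraction:
  fixes S :: "real ^ 'n ^ 'n"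
  assumes "spectral_radius S < \<eta>"
  obtains N where "N > 0" "\<And>x. x \<noteq> 0 \<Longrightarrow> norm (((*v) S ^^ N) x) < \<eta> ^ N * norm x"
proof -
  \<comment> \<open>A rate strictly between leaves a factor \<open>(r / \<eta>)\<^sup>k\<close> to absorb the constant of \<open>orbit_growth\<close>.\<close>
  define r where "r = (spectral_radius S + \<eta>) / 2"
  have r: "spectral_radius S < r" "0 < r" "r < \<eta>"
    using assms spectral_radius_bounds(1)[of S] by (simp_all add: r_def)
  obtain K where K: "\<And>k x. norm (((*v) S ^^ k) x) \<le> K * r ^ k * norm x"
    using orbit_growth[OF r(1)] by blast
  have "(\<lambda>k. K * (r / \<eta>) ^ k) \<longlonglongrightarrow> K * 0"
    using r by (intro tendsto_intros LIMSEQ_power_zero) simp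
  then have "eventually (\<lambda>k. K * (r / \<eta>) ^ k < 1) sequentially"
    by (rule order_tendstoD) simp
  then obtain N where "\<And>k. k \<ge> N \<Longrightarrow> K * (r / \<eta>) ^ k < 1"
    unfolding eventually_sequentially by blast
  then have N: "K * (r / \<eta>) ^ Suc N < 1" using le_SucI by blast
  have lt: "K * r ^ Suc N < \<eta> ^ Suc N"
    using N r by (simp add: power_divide field_simps)
  have "norm (((*v) S ^^ Suc N) x) < \<eta> ^ Suc N * norm x" if "x \<noteq> 0" for x
    using order.strict_trans1[OF K mult_strict_right_mono[OF lt]] that by simp
  then show thesis using that[of "Suc N"] by blast
qed

section \<open>The Stein inequality\<close>

lemma inner_gram: "x \<bullet> ((transpose Q ** Q) *v z) = (Q *v x) \<bullet> (Q *v (z :: real ^ 'n))"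
  for Q :: "real ^ 'n ^ 'm"
  by (metis dot_lmul_matrix inner_commute matrix_vector_mul_assoc transpose_transpose vector_transpose_matrix)

lemma transpose_sum: "transpose (\<Sum>i\<in>I. f i) = (\<Sum>i\<in>I. transpose (f i :: real ^ 'n ^ 'm))"
  by (simp add: vec_eq_iff transpose_def)

text \<open>
  The solution is a truncation of the classical series \<open>P = \<Sum>\<^sub>k \<eta>\<^sup>-\<^sup>2\<^sup>k (S\<^sup>k)\<^sup>T S\<^sup>k\<close>. The form of the truncated
  sum telescopes: passing from \<open>x\<close> to \<open>S x\<close> multiplies it by \<open>\<eta>\<^sup>2\<close>, adds the term of index \<open>N\<close> and
  drops the term of index \<open>0\<close>. If \<open>S\<^sup>N\<close> shrinks every vector by more than \<open>\<eta>\<^sup>N\<close>, the new term is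
  smaller than the dropped one.
\<close>

lemma stein_solution:
  fixes S :: "real ^ 'n ^ 'n"
  assumes "spectral_radius S < \<eta>"
  obtains P where "pos_def P"
    "\<And>x. x \<noteq> 0 \<Longrightarrow> (S *v x) \<bullet> (P *v (S *v x)) < \<eta>\<^sup>2 * (x \<bullet> (P *v x))"
proof -
  have "\<eta> > 0" using assms spectral_radius_bounds(1)[of S] by linarith
  obtain N where "N > 0" and N: "\<And>x. x \<noteq> 0 \<Longrightarrow> norm (((*v) S ^^ N) x) < \<eta> ^ N * norm x"
    by (rule power_contraction[OF assms]) blast
  define Q where "Q k = ((**) S ^^ k) (mat 1)" for k
  have Q: "Q k *v x = ((*v) S ^^ k) x" for k x
    unfolding Q_def by (induction k) (simp_all add: matrix_vector_mul_assoc[symmetric])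
  define P where "P = (\<Sum>k<N. (1 / \<eta> ^ (2 * k)) *\<^sub>R (transpose (Q k) ** Q k))"
  define t where "t x k = (norm (((*v) S ^^ k) x))\<^sup>2 / \<eta> ^ (2 * k)" for x k
  have form: "x \<bullet> (P *v x) = (\<Sum>k<N. t x k)" for x
    by (simp add: P_def sum_matrix_vector_mult inner_sum_right scaleR_matrix_vector_assoc[symmetric]
        inner_gram Q t_def dot_square_norm)
  have "pos_def P"
    unfolding pos_def_def
  proof (intro conjI allI impI)
    show "transpose P = P"
      by (simp add: P_def transpose_sum transpose_scalar matrix_transpose_mul)
    fix x :: "real ^ 'n" assume "x \<noteq> 0"
    have "0 < t x 0" using \<open>x \<noteq> 0\<close> by (simp add: t_def)
    also have "\<dots> \<le> (\<Sum>k<N. t x k)"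
      using \<open>N > 0\<close> \<open>\<eta> > 0\<close> by (intro member_le_sum) (auto simp: t_def)
    finally show "x \<bullet> (P *v x) > 0" by (simp add: form)
  qed
  moreover have "(S *v x) \<bullet> (P *v (S *v x)) < \<eta>\<^sup>2 * (x \<bullet> (P *v x))" if "x \<noteq> 0" for x
  proof -
    have "t (S *v x) k = \<eta>\<^sup>2 * t x (Suc k)" for k
      using \<open>\<eta> > 0\<close> by (simp add: t_def funpow_swap1 power2_eq_square)
    then have "(S *v x) \<bullet> (P *v (S *v x)) = \<eta>\<^sup>2 * (\<Sum>k<N. t x (Suc k))"
      by (simp add: form sum_distrib_left)
    also have "(\<Sum>k<N. t x (Suc k)) = (\<Sum>k<N. t x k) + (t x N - t x 0)"
      using sum_lessThan_telescope[of "t x" N] by (simp add: sum_subtractf)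
    also have "t x N < t x 0"
    proof -
      have "(norm (((*v) S ^^ N) x))\<^sup>2 < (\<eta> ^ N * norm x)\<^sup>2"
        using N[OF that] by (intro power_strict_mono) auto
      then show ?thesis using \<open>\<eta> > 0\<close> by (simp add: t_def field_simps power_mult power2_eq_square)
    qed
    then have "\<eta>\<^sup>2 * ((\<Sum>k<N. t x k) + (t x N - t x 0)) < \<eta>\<^sup>2 * (x \<bullet> (P *v x))"
      using \<open>\<eta> > 0\<close> by (simp add: form)
    finally show ?thesis .
  qed
  ultimately show thesis using that by blast
qed

section \<open>Block matrices and multipliers\<close>

lemma transpose_add: "transpose (X + Y) = transpose X + transpose (Y :: real ^ 'n ^ 'm)"
  by (simp add: vec_eq_iff transpose_def)

lemma transpose_diff: "transpose (X - Y) = transpose X - transpose (Y :: real ^ 'n ^ 'm)"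
  by (simp add: vec_eq_iff transpose_def)

lemma join_vec_nth [simp]:
  "join_vec z g $ Inl a = z $ a" "join_vec z g $ Inr b = g $ b"
  by (simp_all add: join_vec_def)

lemma block_mat_nth [simp]:
  "block_mat M11 M12 M21 M22 $ Inl a = join_vec (M11 $ a) (M12 $ a)"
  "block_mat M11 M12 M21 M22 $ Inr b = join_vec (M21 $ b) (M22 $ b)"
  by (simp_all add: block_mat_def)

lemma vec_sum_eq_iff:
  "x = y \<longleftrightarrow> (\<forall>a. x $ Inl a = y $ Inl a) \<and> (\<forall>b. x $ Inr b = y $ Inr b)"
  for x y :: "'c ^ ('a::finite + 'b::finite)"
  by (simp add: vec_eq_iff split_sum_all)

lemma join_vec_exhaust:
  obtains z g where "y = join_vec z g"
  using that[of "\<chi> a. y $ Inl a" "\<chi> b. y $ Inr b"] by (simp add: vec_sum_eq_iff)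

lemma join_vec_eq_0_iff: "join_vec z g = 0 \<longleftrightarrow> z = 0 \<and> g = 0"
  by (simp add: vec_sum_eq_iff) (simp add: vec_eq_iff)

lemma inner_join_vec: "join_vec a b \<bullet> join_vec c d = a \<bullet> c + b \<bullet> d"
  by (simp add: inner_vec_def UNIV_Plus_UNIV[symmetric] sum.Plus del: UNIV_Plus_UNIV)

lemma block_mat_mult_join_vec:
  "block_mat M11 M12 M21 M22 *v join_vec x u
    = join_vec (M11 *v x + M12 *v u) (M21 *v x + M22 *v u)"
  by (simp add: vec_sum_eq_iff matrix_vector_mul_component inner_join_vec)

lemma transpose_block_mat:
  "transpose (block_mat M11 M12 M21 M22)
    = block_mat (transpose M11) (transpose M21) (transpose M12) (transpose M22)"
  by (simp add: vec_sum_eq_iff) (simp add: transpose_def vec_eq_iff split_sum_all)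

lemma block_mat_eq_iff:
  "block_mat M11 M12 M21 M22 = block_mat N11 N12 N21 N22
    \<longleftrightarrow> M11 = N11 \<and> M12 = N12 \<and> M21 = N21 \<and> M22 = N22"
  by (auto simp: vec_sum_eq_iff) (auto simp: vec_eq_iff)

text \<open>
  The simplifier turns \<^term>\<open>transpose Q *v y\<close> into \<^term>\<open>y v* Q\<close>, so the adjoint identity is
  stated for the latter.
\<close>

lemma inner_vector_matrix_mult: "x \<bullet> (y v* Q) = (Q *v x) \<bullet> y"
  for Q :: "real ^ 'n ^ 'm"
  by (metis dot_lmul_matrix inner_commute)

lemma transpose_scaled_multiplier:
  assumes "transpose M11 = M11" "transpose M22 = M22"
  shows "transpose (scaled_multiplier \<alpha> M11 M12 M22) = scaled_multiplier \<alpha> M11 M12 M22"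
  by (simp add: scaled_multiplier_def transpose_block_mat transpose_scalar assms)

text \<open>
  The scaling of the blocks undoes the scaling of the second component. This one identity gives both
  the multipliers of the scaled mapping and the change of variables in the matrix inequality.
\<close>

lemma scaled_multiplier_form:
  assumes "\<alpha> \<noteq> 0"
  shows "join_vec z (\<alpha> *\<^sub>R h) \<bullet> (scaled_multiplier \<alpha> M11 M12 M22 *v join_vec z (\<alpha> *\<^sub>R h))
    = join_vec z h \<bullet> (block_mat M11 M12 (transpose M12) M22 *v join_vec z h)"
  using assms
  by (simp add: scaled_multiplier_def block_mat_mult_join_vec inner_join_vec inner_add_right
      matrix_vector_mult_scaleR scaleR_matrix_vector_assoc[symmetric] power2_eq_square)

lemma admits_IMM_scaled:
  assumes "\<alpha> > 0" and "\<And>z. \<Psi> z = (\<lambda>g. \<alpha> *\<^sub>R g) ` \<Phi> z"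
    and "admits_IMM \<Phi> (block_mat M11 M12 (transpose M12) M22)"
  shows "admits_IMM \<Psi> (scaled_multiplier \<alpha> M11 M12 M22)"
  unfolding admits_IMM_def
proof (intro conjI allI ballI)
  have "transpose M11 = M11" "transpose M22 = M22"
    using assms(3) by (simp_all add: admits_IMM_def transpose_block_mat block_mat_eq_iff)
  then show "transpose (scaled_multiplier \<alpha> M11 M12 M22) = scaled_multiplier \<alpha> M11 M12 M22"
    by (rule transpose_scaled_multiplier)
  fix z1 z2 g1 g2 assume "g1 \<in> \<Psi> z1" "g2 \<in> \<Psi> z2"
  then obtain h1 h2 where h: "h1 \<in> \<Phi> z1" "h2 \<in> \<Phi> z2" "g1 - g2 = \<alpha> *\<^sub>R (h1 - h2)"
    unfolding assms(2) by (auto simp: scaleR_diff_right)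
  have "0 \<le> join_vec (z1 - z2) (h1 - h2)
      \<bullet> (block_mat M11 M12 (transpose M12) M22 *v join_vec (z1 - z2) (h1 - h2))"
    using assms(3) h(1,2) unfolding admits_IMM_def by blast
  then show "0 \<le> join_vec (z1 - z2) (g1 - g2)
      \<bullet> (scaled_multiplier \<alpha> M11 M12 M22 *v join_vec (z1 - z2) (g1 - g2))"
    using scaled_multiplier_form[of \<alpha> "z1 - z2" "h1 - h2" M11 M12 M22] \<open>\<alpha> > 0\<close> h(3) by simp
qed

text \<open>
  Linearity in the blocks reduces a linear combination of multipliers to a single multiplier.
\<close>

lemma sum_scaled_multiplier:
  "(\<Sum>i\<in>I. l i *\<^sub>R scaled_multiplier \<alpha> (M11 i) (M12 i) (M22 i))
    = scaled_multiplier \<alpha> (\<Sum>i\<in>I. l i *\<^sub>R M11 i) (\<Sum>i\<in>I. l i *\<^sub>R M12 i) (\<Sum>i\<in>I. l i *\<^sub>R M22 i)"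
  by (simp add: scaled_multiplier_def vec_sum_eq_iff)
    (simp add: vec_eq_iff split_sum_all transpose_def sum_divide_distrib)

lemma transpose_sol:
  "transpose (sol F G C D M) = sol F G C D (transpose M)"
  by (simp add: sol_def matrix_transpose_mul matrix_mul_assoc)

text \<open>
  In terms of the signals, the outer matrix of \<^const>\<open>sol\<close> computes \<open>z = F x + G u\<close> and the value
  \<open>- (C x + D u)\<close> that the inclusion requires to lie in \<open>\<Psi>(z)\<close>.
\<close>

lemma sol_form:
  "join_vec x u \<bullet> (sol F G C D M *v join_vec x u)
    = join_vec (F *v x + G *v u) (- (C *v x + D *v u))
        \<bullet> (M *v join_vec (F *v x + G *v u) (- (C *v x + D *v u)))"
proof -
  have neg: "- X *v y = - (X *v y)" for X :: "real ^ 'x ^ 'y" and y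
    by (simp add: vec_eq_iff matrix_vector_mult_def sum_negf)
  have "block_mat F G (- C) (- D) *v join_vec x u
      = join_vec (F *v x + G *v u) (- (C *v x + D *v u))"
    by (simp add: block_mat_mult_join_vec neg)
  then show ?thesis
    by (simp add: sol_def matrix_vector_mul_assoc[symmetric] inner_vector_matrix_mult)
qed

section \<open>Finsler's lemma on compact sets\<close>

text \<open>
  A form of Finsler's lemma. Where \<open>g \<ge> 0\<close>, compactness keeps \<open>f\<close> away from \<open>0\<close>, so a large multiple of
  \<open>f\<close> outweighs the maximum of \<open>g\<close> there; everywhere else \<open>f \<le> 0\<close> suffices.
\<close>

lemma finsler_compact:
  fixes f g :: "'a::topological_space \<Rightarrow> real"
  assumes "compact K" "continuous_on K f" "continuous_on K g"
    and le: "\<And>y. y \<in> K \<Longrightarrow> f y \<le> 0"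
    and neg: "\<And>y. y \<in> K \<Longrightarrow> f y = 0 \<Longrightarrow> g y < 0"
  obtains k where "k > 0" "\<And>y. y \<in> K \<Longrightarrow> k * f y + g y < 0"
proof (cases "{y\<in>K. g y \<ge> 0} = {}")
  case True
  have "f y + g y < 0" if "y \<in> K" for y
    using True le[OF that] that by fastforce
  then show thesis using that[of 1] by simp
next
  case False
  let ?K = "{y\<in>K. g y \<ge> 0}"
  have "?K = K \<inter> g -` {0..}" by auto
  then have K: "compact ?K"
    using closedin_compact[OF assms(1)] continuous_closedin_preimage[OF assms(3), of "{0..}"]
    by simp
  have fg: "continuous_on ?K f" "continuous_on ?K g"
    by (rule continuous_on_subset[OF assms(2)] continuous_on_subset[OF assms(3)]; auto)+
  obtain m where m: "m \<in> ?K" "\<And>y. y \<in> ?K \<Longrightarrow> f y \<le> f m"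
    using continuous_attains_sup[OF K False fg(1)] by blast
  obtain n where n: "n \<in> ?K" "\<And>y. y \<in> ?K \<Longrightarrow> g y \<le> g n"
    using continuous_attains_sup[OF K False fg(2)] by blast
  have fm: "f m < 0" using m(1) le[of m] neg[of m] by (cases "f m = 0") auto
  \<comment> \<open>Chosen so that \<open>k * f\<close> is at most \<open>- (max g + 1)\<close> where \<open>g \<ge> 0\<close>.\<close>
  define k where "k = (g n + 1) / - f m"
  have k: "k > 0" "k * f m = - (g n + 1)" using fm n(1) by (auto simp: k_def divide_pos_neg)
  have "k * f y + g y < 0" if "y \<in> K" for y
  proof (cases "g y \<ge> 0")
    case True
    then have "k * f y \<le> k * f m" using m(2)[of y] that k(1) by (simp add: mult_left_mono)
    then show ?thesis using n(2)[of y] True that k(2) by simp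
  next
    case False
    then show ?thesis using mult_nonneg_nonpos[of k "f y"] k(1) le[OF that] by linarith
  qed
  then show thesis using that k(1) by blast
qed

text \<open>
  Strict negativity on a compact set survives a small change of a parameter (tube lemma), so
  Finsler's lemma at parameter value \<open>0\<close> gives the conclusion at a small positive one.
\<close>

lemma finsler_perturbed:
  fixes f g :: "real \<times> 'a::metric_space \<Rightarrow> real"
  assumes "compact K" "continuous_on UNIV f" "continuous_on UNIV g"
    and le: "\<And>y. y \<in> K \<Longrightarrow> f (0, y) \<le> 0"
    and neg: "\<And>y. y \<in> K \<Longrightarrow> f (0, y) = 0 \<Longrightarrow> g (0, y) < 0"
  obtains k \<alpha> where "k > 0" "\<alpha> > 0" "\<And>y. y \<in> K \<Longrightarrow> k * f (\<alpha>, y) + g (\<alpha>, y) < 0"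
proof -
  have "continuous_on K (\<lambda>y. f (0, y))" "continuous_on K (\<lambda>y. g (0, y))"
    by (rule continuous_on_compose2[OF assms(2)] continuous_on_compose2[OF assms(3)];
        force intro!: continuous_intros)+
  then obtain k where k: "k > 0" "\<And>y. y \<in> K \<Longrightarrow> k * f (0, y) + g (0, y) < 0"
    using finsler_compact[of K "\<lambda>y. f (0, y)" "\<lambda>y. g (0, y)", OF assms(1) _ _ le neg] by blast
  define W where "W = {w. k * f w + g w < 0}"
  have "open W"
    unfolding W_def using assms(2,3) by (intro open_Collect_less continuous_intros)
  moreover have "{0} \<times> K \<subseteq> W" using k(2) by (auto simp: W_def)
  ultimately have "\<exists>X. 0 \<in> X \<and> open X \<and> X \<times> K \<subseteq> W"
    by (rule Elementary_Topology.tube_lemma[OF \<open>compact K\<close>])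
  then obtain X where X: "0 \<in> X" "open X" "X \<times> K \<subseteq> W" by blast
  then obtain e where e: "e > 0" "ball 0 e \<subseteq> X" using openE by blast
  then have "e / 2 \<in> X" by (auto simp: dist_norm)
  then have "k * f (e / 2, y) + g (e / 2, y) < 0" if "y \<in> K" for y
    using X(3) that by (auto simp: W_def)
  then show thesis using that[of k "e / 2"] k(1) e(1) by simp
qed

section \<open>The matrix inequality for the Lur'e system\<close>

lemma matrix_inv_inverse:
  assumes "invertible D"
  shows "D ** matrix_inv D = mat 1" "matrix_inv D ** D = mat 1"
  using someI_ex[OF assms[unfolded invertible_def]] unfolding matrix_inv_def by blast+

lemma quadratic_state_form:
  fixes A :: "real ^ 'n ^ 'n" and B :: "real ^ 'm ^ 'n"
  shows "join_vec x u \<bullet> (block_mat (transpose A ** P ** A - \<eta>\<^sup>2 *\<^sub>R P) (transpose A ** P ** B)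
                            (transpose B ** P ** A) (transpose B ** P ** B) *v join_vec x u)
    = (A *v x + B *v u) \<bullet> (P *v (A *v x + B *v u)) - \<eta>\<^sup>2 * (x \<bullet> (P *v x))"
  by (simp add: block_mat_mult_join_vec inner_join_vec inner_add_right inner_add_left
      inner_diff_right matrix_vector_mult_diff_rdistrib matrix_vector_right_distrib
      matrix_vector_mul_assoc[symmetric] inner_vector_matrix_mult scaleR_matrix_vector_assoc[symmetric])


text \<open>
  The input \<open>u\<close> is replaced by the rescaled nonlinearity value \<open>h = -(C x + D u) / \<alpha>\<close>, which is
  possible because \<open>D\<close> is invertible. The matrix inequality then says that \<open>k f + g\<close> is negative at \<open>(\<alpha>, x, h)\<close>,
  where \<open>P = k P\<^sub>0\<close>, \<open>f\<close> is the change of the Lyapunov form and \<open>g\<close> is the multiplier form. Both are polynomial in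
  \<open>\<alpha>\<close>, so they make sense at \<open>\<alpha> = 0\<close>, where \<open>f\<close> depends on \<open>x\<close> alone and is negative for
  \<open>x \<noteq> 0\<close>, while \<open>g\<close> at \<open>x = 0\<close> is the form of \<open>M22\<close>. These are the hypotheses of
  \<open>finsler_perturbed\<close> on the unit sphere, which yields \<open>k\<close> and a positive \<open>\<alpha>\<close>.
\<close>

lemma exists_scaled_lmi_solution:
  fixes A :: "real ^ 'n ^ 'n" and B :: "real ^ 'm ^ 'n"
    and C :: "real ^ 'n ^ 'm" and D :: "real ^ 'm ^ 'm"
    and F :: "real ^ 'n ^ 'r" and G :: "real ^ 'm ^ 'r"
  assumes "invertible D" and "spectral_radius (A - B ** matrix_inv D ** C) < \<eta>"
    and M11: "transpose M11 = M11" and M22: "neg_def M22"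
  obtains P \<alpha> where "pos_def P" "\<alpha> > 0"
    "neg_def (block_mat (transpose A ** P ** A - \<eta>\<^sup>2 *\<^sub>R P) (transpose A ** P ** B)
                        (transpose B ** P ** A) (transpose B ** P ** B)
      + sol F G C D (scaled_multiplier \<alpha> M11 M12 M22))"
proof -
  define E where "E = matrix_inv D"
  have E: "D *v (E *v y) = y" "E *v (D *v y) = y" for y
    using matrix_inv_inverse[OF assms(1)] by (simp_all add: E_def matrix_vector_mul_assoc)
  define S where "S = A - B ** E ** C"
  have S: "S *v x = A *v x - B *v (E *v (C *v x))" for x
    by (simp add: S_def matrix_vector_mult_diff_rdistrib matrix_vector_mul_assoc matrix_mul_assoc)
  obtain P0 where P0: "pos_def P0"
    "\<And>x. x \<noteq> 0 \<Longrightarrow> (S *v x) \<bullet> (P0 *v (S *v x)) < \<eta>\<^sup>2 * (x \<bullet> (P0 *v x))"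
    using stein_solution assms(2) unfolding S_def E_def by blast
  define N where "N = block_mat M11 M12 (transpose M12) M22"
  \<comment> \<open>The functions \<open>state\<close> and \<open>out\<close> are \<open>A x + B u\<close> and \<open>F x + G u\<close> after eliminating
     \<open>u = - D\<^sup>-\<^sup>1 (C x + \<alpha> h)\<close>.\<close>
  define state :: "real \<times> (real ^ 'n) \<times> (real ^ 'm) \<Rightarrow> real ^ 'n" where
    "state = (\<lambda>(\<alpha>, x, h). S *v x - \<alpha> *\<^sub>R (B *v (E *v h)))"
  define out :: "real \<times> (real ^ 'n) \<times> (real ^ 'm) \<Rightarrow> real ^ 'r" where
    "out = (\<lambda>(\<alpha>, x, h). F *v x - G *v (E *v (C *v x)) - \<alpha> *\<^sub>R (G *v (E *v h)))"
  define f :: "real \<times> (real ^ 'n) \<times> (real ^ 'm) \<Rightarrow> real" where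
    "f = (\<lambda>w. state w \<bullet> (P0 *v state w) - \<eta>\<^sup>2 * (fst (snd w) \<bullet> (P0 *v fst (snd w))))"
  define g :: "real \<times> (real ^ 'n) \<times> (real ^ 'm) \<Rightarrow> real" where
    "g = (\<lambda>w. out w \<bullet> (M11 *v out w + M12 *v snd (snd w))
      + snd (snd w) \<bullet> (transpose M12 *v out w + M22 *v snd (snd w)))"
  have g_join: "g w = join_vec (out w) (snd (snd w)) \<bullet> (N *v join_vec (out w) (snd (snd w)))" for w
    by (simp add: g_def N_def block_mat_mult_join_vec inner_join_vec)
  have contv: "continuous_on UNIV (\<lambda>w. X *v h w)" if "continuous_on UNIV h"
    for X :: "real ^ 'x ^ 'y" and h :: "real \<times> (real ^ 'n) \<times> (real ^ 'm) \<Rightarrow> real ^ 'x"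
    using continuous_on_compose2[OF matrix_vector_mult_linear_continuous_on[of UNIV X] that] by simp
  have "continuous_on UNIV state" "continuous_on UNIV out"
    unfolding state_def out_def case_prod_unfold by (intro continuous_intros contv)+
  then have cont: "continuous_on UNIV f" "continuous_on UNIV g"
    unfolding f_def g_def by (intro continuous_intros contv; simp)+
  have f_neg: "f (0, x, h) < 0" if "x \<noteq> 0" for x h
    using P0(2)[OF that] by (simp add: f_def state_def)
  have f_zero: "f (0, 0, h) = 0" for h
    by (simp add: f_def state_def)
  have "f (0, y) \<le> 0" if "y \<in> sphere 0 1" for y
    using f_neg f_zero by (cases y) (metis order.strict_implies_order order_refl)
  moreover have "g (0, y) < 0" if y: "y \<in> sphere 0 1" "f (0, y) = 0" for y
  proof -
    obtain x h where xh: "y = (x, h)" by (cases y)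
    have "x = 0" using y(2) f_neg[of x h] xh by fastforce
    moreover from this have "h \<noteq> 0" using y(1) xh by auto
    ultimately show ?thesis
      using M22 xh by (simp add: g_def out_def neg_def_def)
  qed
  ultimately obtain k \<alpha> where k: "k > 0" "\<alpha> > 0"
      "\<And>y. y \<in> sphere 0 1 \<Longrightarrow> k * f (\<alpha>, y) + g (\<alpha>, y) < 0"
    using finsler_perturbed[OF compact_sphere cont] by blast
  have scale: "state (\<alpha>, c *\<^sub>R y) = c *\<^sub>R state (\<alpha>, y)" "out (\<alpha>, c *\<^sub>R y) = c *\<^sub>R out (\<alpha>, y)" for c y
    by (cases y; simp add: state_def out_def matrix_vector_mult_scaleR scaleR_diff_right mult.commute)+
  \<comment> \<open>For fixed \<open>\<alpha>\<close> both functions are homogeneous of degree two.\<close>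
  have neg: "k * f (\<alpha>, y) + g (\<alpha>, y) < 0" if "y \<noteq> 0" for y
  proof -
    define c where "c = norm y"
    define s where "s = (1 / c) *\<^sub>R y"
    have c: "c > 0" "s \<in> sphere 0 1" "y = c *\<^sub>R s" using that by (simp_all add: c_def s_def)
    have "f (\<alpha>, y) = c\<^sup>2 * f (\<alpha>, s)" "g (\<alpha>, y) = c\<^sup>2 * g (\<alpha>, s)"
      unfolding c(3) f_def g_def
      by (simp_all add: scale matrix_vector_mult_scaleR power2_eq_square algebra_simps)
    then have "k * f (\<alpha>, y) + g (\<alpha>, y) = c\<^sup>2 * (k * f (\<alpha>, s) + g (\<alpha>, s))"
      by (simp add: algebra_simps)
    then show ?thesis using k(3)[OF c(2)] c(1) by (simp add: mult_pos_neg)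
  qed
  define P where "P = k *\<^sub>R P0"
  have P: "pos_def P"
    using P0(1) k(1) by (simp add: pos_def_def P_def transpose_scalar scaleR_matrix_vector_assoc[symmetric])
  let ?L = "block_mat (transpose A ** P ** A - \<eta>\<^sup>2 *\<^sub>R P) (transpose A ** P ** B)
                      (transpose B ** P ** A) (transpose B ** P ** B)"
  let ?R = "sol F G C D (scaled_multiplier \<alpha> M11 M12 M22)"
  have "neg_def (?L + ?R)"
    unfolding neg_def_def
  proof (intro conjI allI impI)
    have "transpose P = P" "transpose M22 = M22" using P M22 by (simp_all add: pos_def_def neg_def_def)
    then show "transpose (?L + ?R) = ?L + ?R"
      by (simp add: transpose_add transpose_diff transpose_scalar transpose_block_mat transpose_sol
          transpose_scaled_multiplier M11 matrix_transpose_mul matrix_mul_assoc)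
    fix v :: "real ^ ('n + 'm)" assume "v \<noteq> 0"
    obtain x u where v: "v = join_vec x u" by (rule join_vec_exhaust)
    define h where "h = - (1 / \<alpha>) *\<^sub>R (C *v x + D *v u)"
    have h: "\<alpha> *\<^sub>R h = - (C *v x + D *v u)" using k(2) by (simp add: h_def)
    have "\<alpha> *\<^sub>R (E *v h) = E *v (\<alpha> *\<^sub>R h)" by (simp add: matrix_vector_mult_scaleR)
    also have "\<dots> = E *v (0 - (C *v x + D *v u))" by (simp add: h)
    also have "\<dots> = - (E *v (C *v x)) - u"
      unfolding matrix_vector_mult_diff_distrib matrix_vector_right_distrib by (simp add: E)
    finally have Eh: "\<alpha> *\<^sub>R (X *v (E *v h)) = - (X *v (E *v (C *v x))) - X *v u" for X :: "real ^ 'm ^ 'y"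
      by (metis (no_types) diff_0 matrix_vector_mult_0_right matrix_vector_mult_diff_distrib
          matrix_vector_mult_scaleR)
    have state: "state (\<alpha>, x, h) = A *v x + B *v u" and out: "out (\<alpha>, x, h) = F *v x + G *v u"
      by (simp_all add: state_def out_def Eh S)
    have "(x, h) \<noteq> 0"
    proof
      assume "(x, h) = 0"
      then have "x = 0" "h = 0" by (simp_all add: zero_prod_def)
      with h have "D *v u = 0" by simp
      then have "u = 0" using E(2)[of u] by simp
      with \<open>x = 0\<close> \<open>v \<noteq> 0\<close> v show False by (simp add: join_vec_eq_0_iff)
    qed
    then have "k * f (\<alpha>, x, h) + g (\<alpha>, x, h) < 0" by (rule neg)
    also have "k * f (\<alpha>, x, h) = v \<bullet> (?L *v v)"
      unfolding v quadratic_state_form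
      by (simp add: f_def state P_def scaleR_matrix_vector_assoc[symmetric] algebra_simps)
    also have "g (\<alpha>, x, h) = v \<bullet> (?R *v v)"
      unfolding v sol_form h[symmetric] using k(2)
      by (simp add: scaled_multiplier_form g_join out N_def)
    finally show "v \<bullet> ((?L + ?R) *v v) < 0"
      by (simp add: matrix_vector_mult_add_rdistrib inner_add_right)
  qed
  with P k(2) show thesis by (rule that)
qed

theorem proposition2:
  fixes A :: "real ^ 'n ^ 'n" and B :: "real ^ 'm ^ 'n"
    and C :: "real ^ 'n ^ 'm" and D :: "real ^ 'm ^ 'm"
    and F :: "real ^ 'n ^ 'r" and G :: "real ^ 'm ^ 'r"
    and \<Psi> \<Psi>base :: "nat \<Rightarrow> real ^ 'r \<Rightarrow> (real ^ 'm) set"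
    and \<alpha> :: real and p :: nat
    and M11 :: "nat \<Rightarrow> real ^ 'r ^ 'r" and M12 :: "nat \<Rightarrow> real ^ 'm ^ 'r"
    and M22 :: "nat \<Rightarrow> real ^ 'm ^ 'm"
  assumes "\<alpha> > 0"
    and "\<And>t z. \<Psi> t z = (\<lambda>g. \<alpha> *\<^sub>R g) ` \<Psi>base t z"
    and "\<And>t i. i \<in> {1..p} \<Longrightarrow>
           admits_IMM (\<Psi>base t) (block_mat (M11 i) (M12 i) (transpose (M12 i)) (M22 i))"
  shows "(\<forall>t. \<forall>i\<in>{1..p}. admits_IMM (\<Psi> t) (scaled_multiplier \<alpha> (M11 i) (M12 i) (M22 i))) \<and>
    (invertible D \<and> schur (A - B ** matrix_inv D ** C) \<and>
     (\<exists>l' :: nat \<Rightarrow> real. (\<forall>i\<in>{1..p}. l' i \<ge> 0) \<and> neg_def (\<Sum>i=1..p. l' i *\<^sub>R M22 i))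
     \<longrightarrow> (\<forall>\<eta>\<in>{spectral_radius (A - B ** matrix_inv D ** C)<..<1}.
            \<exists>(P :: real ^ 'n ^ 'n) (l :: nat \<Rightarrow> real) (\<alpha>' :: real).
              pos_def P \<and> (\<forall>i\<in>{1..p}. l i \<ge> 0) \<and> \<alpha>' > 0 \<and>
              neg_def (block_mat (transpose A ** P ** A - \<eta>\<^sup>2 *\<^sub>R P) (transpose A ** P ** B)
                                 (transpose B ** P ** A) (transpose B ** P ** B)
                + sol F G C D
                    (\<Sum>i=1..p. l i *\<^sub>R scaled_multiplier \<alpha>' (M11 i) (M12 i) (M22 i)))))"
proof (intro conjI allI ballI impI)
  fix t i assume "i \<in> {1..p}"
  then show "admits_IMM (\<Psi> t) (scaled_multiplier \<alpha> (M11 i) (M12 i) (M22 i))"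
    using admits_IMM_scaled[of \<alpha> "\<Psi> t" "\<Psi>base t", OF assms(1,2)] assms(3) by blast
next
  fix \<eta>
  assume D: "invertible D \<and> schur (A - B ** matrix_inv D ** C) \<and>
     (\<exists>l' :: nat \<Rightarrow> real. (\<forall>i\<in>{1..p}. l' i \<ge> 0) \<and> neg_def (\<Sum>i=1..p. l' i *\<^sub>R M22 i))"
    and \<eta>: "\<eta> \<in> {spectral_radius (A - B ** matrix_inv D ** C)<..<1}"
  then obtain l' :: "nat \<Rightarrow> real" where l': "\<forall>i\<in>{1..p}. l' i \<ge> 0"
    "neg_def (\<Sum>i=1..p. l' i *\<^sub>R M22 i)" by blast
  have "transpose (M11 i) = M11 i" if "i \<in> {1..p}" for i
    using assms(3)[OF that] by (simp add: admits_IMM_def transpose_block_mat block_mat_eq_iff)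
  then have sym: "transpose (\<Sum>i=1..p. l' i *\<^sub>R M11 i) = (\<Sum>i=1..p. l' i *\<^sub>R M11 i)"
    by (simp add: transpose_sum transpose_scalar)
  have "spectral_radius (A - B ** matrix_inv D ** C) < \<eta>" using \<eta> by simp
  then obtain P \<alpha>' where P: "pos_def P" "\<alpha>' > 0" and
    "neg_def (block_mat (transpose A ** P ** A - \<eta>\<^sup>2 *\<^sub>R P) (transpose A ** P ** B)
                        (transpose B ** P ** A) (transpose B ** P ** B)
      + sol F G C D (scaled_multiplier \<alpha>'
          (\<Sum>i=1..p. l' i *\<^sub>R M11 i) (\<Sum>i=1..p. l' i *\<^sub>R M12 i) (\<Sum>i=1..p. l' i *\<^sub>R M22 i)))"
    by (rule exists_scaled_lmi_solution[OF conjunct1[OF D] _ sym l'(2)])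
  then have "neg_def (block_mat (transpose A ** P ** A - \<eta>\<^sup>2 *\<^sub>R P) (transpose A ** P ** B)
                        (transpose B ** P ** A) (transpose B ** P ** B)
      + sol F G C D (\<Sum>i=1..p. l' i *\<^sub>R scaled_multiplier \<alpha>' (M11 i) (M12 i) (M22 i)))"
    by (simp only: sum_scaled_multiplier)
  with P l'(1) show "\<exists>(P :: real ^ 'n ^ 'n) (l :: nat \<Rightarrow> real) (\<alpha>' :: real).
              pos_def P \<and> (\<forall>i\<in>{1..p}. l i \<ge> 0) \<and> \<alpha>' > 0 \<and>
              neg_def (block_mat (transpose A ** P ** A - \<eta>\<^sup>2 *\<^sub>R P) (transpose A ** P ** B)
                                 (transpose B ** P ** A) (transpose B ** P ** B)
                + sol F G C D
                    (\<Sum>i=1..p. l i *\<^sub>R scaled_multiplier \<alpha>' (M11 i) (M12 i) (M22 i)))"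
    by blast
qed

end
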